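(* Let $d$ be a $\mathbb{D}_{\mathrm{tree}}$-generic real over $V$. Then for any unbounded real $x\in\omega^\omega\cap V[d]$ there is some dominating real $y\in\omega^\omega\cap V[d]$ such that $x$ is not eventually dominated by $y$ (i.e. it is not the case that $x\leq^* y$).
   Context: For $x,y\in\omega^\omega$, $x\leq^* y$ means $x(n)\leq y(n)$ for all but finitely many $n$. In a generic extension $V[G]$, a real $y\in\omega^\omega$ is dominating if $f\leq^* y$ for every $f\in V\cap\omega^\omega$, and a real $x\in\omega^\omega$ is unbounded if $x\not\leq^* f$ for every $f\in V\cap\omega^\omega$. Tree Hechler forcing $\mathbb{D}_{\mathrm{tree}}$: conditions are trees $T\subseteq\omega^{<\omega}$ with a distinguished stem $s=\mathrm{stem}(T)$ such that every $t\in T$ is comparable with $s$, and whenever $t\in T$ extends $s$, $t^\frown n\in T$ for all but finitely many $n$; ordered by inclusion. The $\mathbb{D}_{\mathrm{tree}}$-generic real is the union of the stems of conditions in the generic filter. *)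

theory Defs
  imports Complex_Main "HOL-Library.Sublist"
begin

section \<open>Tree Hechler forcing\<close>

definition is_tree :: "nat list set \<Rightarrow> bool" where
  "is_tree T \<longleftrightarrow> (\<forall>t\<in>T. \<forall>u. prefix u t \<longrightarrow> u \<in> T)"

definition is_stem :: "nat list \<Rightarrow> nat list set \<Rightarrow> bool" where
  "is_stem s T \<longleftrightarrow> s \<in> T \<and>
     (\<forall>t\<in>T. prefix t s \<or> prefix s t) \<and>
     (\<forall>t\<in>T. prefix s t \<longrightarrow> finite {n. t @ [n] \<notin> T})"

typedef dtree = "{T. is_tree T \<and> (\<exists>s. is_stem s T)}"
  morphisms nodes Abs_dtree
proof
  show "UNIV \<in> {T. is_tree T \<and> (\<exists>s. is_stem s T)}"
    by (auto simp: is_tree_def is_stem_def intro!: exI[of _ "[]"])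
qed

text \<open>The distinguished stem is determined by the tree, see \<open>is_stem_unique\<close> below.\<close>

definition stem :: "dtree \<Rightarrow> nat list" where
  "stem p = (THE s. is_stem s (nodes p))"

definition extends :: "dtree \<Rightarrow> dtree \<Rightarrow> bool" (infix "\<preceq>" 50) where
  "q \<preceq> p \<longleftrightarrow> nodes q \<subseteq> nodes p"

definition top_cond :: dtree where
  "top_cond = Abs_dtree UNIV"


section \<open>The forcing relation\<close>

text \<open>
  The ground model \<open>V\<close> is the universe of HOL. A sentence of the forcing language is
  represented by the predicate of being forced; the clauses for the primitive connectives are the
  usual recursive clauses of the forcing relation, and the remaining connectives are the classical
  abbreviations. A sentence holds in \<open>V[G]\<close> for every generic \<open>G\<close> iff it is forced by
  every condition.
\<close>

type_synonym sentence = "dtree \<Rightarrow> bool"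

definition forces :: "dtree \<Rightarrow> sentence \<Rightarrow> bool" (infix "\<tturnstile>" 15) where
  "(p \<tturnstile> \<phi>) \<longleftrightarrow> \<phi> p"

definition f_not :: "sentence \<Rightarrow> sentence" ("\<^bold>\<not> _" [40] 40) where
  "(\<^bold>\<not> \<phi>) = (\<lambda>p. \<forall>q. q \<preceq> p \<longrightarrow> \<not> (q \<tturnstile> \<phi>))"

definition f_and :: "sentence \<Rightarrow> sentence \<Rightarrow> sentence" (infixr "\<^bold>\<and>" 35) where
  "(\<phi> \<^bold>\<and> \<psi>) = (\<lambda>p. (p \<tturnstile> \<phi>) \<and> (p \<tturnstile> \<psi>))"

text \<open>The bound variable ranges over natural numbers, over ground model reals, or over names,
  according to its type.\<close>

definition f_all :: "('a \<Rightarrow> sentence) \<Rightarrow> sentence" (binder "\<^bold>\<forall>" 10) where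
  "f_all \<phi> = (\<lambda>p. \<forall>a. p \<tturnstile> \<phi> a)"

definition f_imp :: "sentence \<Rightarrow> sentence \<Rightarrow> sentence" (infixr "\<^bold>\<longrightarrow>" 25) where
  "(\<phi> \<^bold>\<longrightarrow> \<psi>) = (\<^bold>\<not> (\<phi> \<^bold>\<and> \<^bold>\<not> \<psi>))"

definition f_ex :: "('a \<Rightarrow> sentence) \<Rightarrow> sentence" (binder "\<^bold>\<exists>" 10) where
  "f_ex \<phi> = (\<^bold>\<not> (\<^bold>\<forall>a. \<^bold>\<not> \<phi> a))"

definition f_iff :: "sentence \<Rightarrow> sentence \<Rightarrow> sentence" (infixr "\<^bold>\<longleftrightarrow>" 25) where
  "(\<phi> \<^bold>\<longleftrightarrow> \<psi>) = ((\<phi> \<^bold>\<longrightarrow> \<psi>) \<^bold>\<and> (\<psi> \<^bold>\<longrightarrow> \<phi>))"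

text \<open>Absolute statements about elements of the ground model.\<close>

definition f_ground :: "bool \<Rightarrow> sentence" ("\<langle>_\<rangle>") where
  "\<langle>b\<rangle> = (\<lambda>p. b)"

text \<open>
  A name \<open>x\<close> for a subset of \<open>\<omega> \<times> \<omega>\<close>, where \<open>((n, k), s) \<in> x\<close> means that the pair
  \<open>(n, k)\<close> is put into the interpretation of \<open>x\<close> if \<open>s \<in> G\<close>. Every subset of
  \<open>\<omega> \<times> \<omega>\<close> in \<open>V[G]\<close>, hence every real in \<open>V[G]\<close>, is the interpretation of such a name.
\<close>

type_synonym name = "((nat \<times> nat) \<times> dtree) set"

definition f_mem :: "nat \<times> nat \<Rightarrow> name \<Rightarrow> sentence" (infix "\<^bold>\<in>" 50) where
  "(a \<^bold>\<in> x) = (\<lambda>p. \<forall>q. q \<preceq> p \<longrightarrow> (\<exists>r s. r \<preceq> q \<and> r \<preceq> s \<and> (a, s) \<in> x))"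

definition check_name :: "(nat \<Rightarrow> nat) \<Rightarrow> name" where
  "check_name f = {((n, f n), top_cond) | n. True}"


section \<open>Reals in the generic extension\<close>

definition is_real :: "name \<Rightarrow> sentence" where
  "is_real x = (\<^bold>\<forall>n. (\<^bold>\<exists>k. (n, k) \<^bold>\<in> x) \<^bold>\<and>
     (\<^bold>\<forall>j. \<^bold>\<forall>k. (n, j) \<^bold>\<in> x \<^bold>\<and> (n, k) \<^bold>\<in> x \<^bold>\<longrightarrow> \<langle>j = k\<rangle>))"

definition le_star :: "name \<Rightarrow> name \<Rightarrow> sentence" (infix "\<^bold>\<le>\<^sup>*" 50) where
  "(x \<^bold>\<le>\<^sup>* y) = (\<^bold>\<exists>m. \<^bold>\<forall>n. \<langle>m \<le> n\<rangle> \<^bold>\<longrightarrow>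
     (\<^bold>\<exists>j. \<^bold>\<exists>k. (n, j) \<^bold>\<in> x \<^bold>\<and> (n, k) \<^bold>\<in> y \<^bold>\<and> \<langle>j \<le> k\<rangle>))"

definition dominating :: "name \<Rightarrow> sentence" where
  "dominating y = (\<^bold>\<forall>f. check_name f \<^bold>\<le>\<^sup>* y)"

definition unbounded :: "name \<Rightarrow> sentence" where
  "unbounded x = (\<^bold>\<forall>f. \<^bold>\<not> (x \<^bold>\<le>\<^sup>* check_name f))"


section \<open>The generic real\<close>

text \<open>
  The name of the union \<open>d\<close> of the stems of the conditions in \<open>G\<close>. Theorem
  \<open>generic_filter_from_real\<close> shows that \<open>G\<close> can be recovered from \<open>d\<close> as the set of all
  conditions through which \<open>d\<close> is a branch, so that \<open>V[d] = V[G]\<close>.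
\<close>

definition generic_real :: name where
  "generic_real = {((n, stem p ! n), p) | n p. n < length (stem p)}"

definition in_generic :: "dtree \<Rightarrow> sentence" where
  "in_generic s = (\<lambda>p. \<forall>q. q \<preceq> p \<longrightarrow> (\<exists>r. r \<preceq> q \<and> r \<preceq> s))"

definition is_branch :: "name \<Rightarrow> dtree \<Rightarrow> sentence" where
  "is_branch x s = (\<^bold>\<forall>n. \<^bold>\<exists>t. \<langle>t \<in> nodes s \<and> length t = n\<rangle> \<^bold>\<and>
     (\<^bold>\<forall>i. \<langle>i < n\<rangle> \<^bold>\<longrightarrow> (i, t ! i) \<^bold>\<in> x))"

lemma extends_refl [simp]: "p \<preceq> p"
  by (simp add: extends_def)

lemma extends_trans [trans]: "r \<preceq> q \<Longrightarrow> q \<preceq> p \<Longrightarrow> r \<preceq> p"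
  by (auto simp: extends_def)

lemma nodes_top_cond [simp]: "nodes top_cond = UNIV"
  unfolding top_cond_def
  by (rule Abs_dtree_inverse) (auto simp: is_tree_def is_stem_def intro!: exI[of _ "[]"])

lemma extends_top_cond [simp]: "p \<preceq> top_cond"
  by (simp add: extends_def)

lemma forces_not: "(p \<tturnstile> \<^bold>\<not> \<phi>) \<longleftrightarrow> (\<forall>q. q \<preceq> p \<longrightarrow> \<not> (q \<tturnstile> \<phi>))"
  by (simp add: forces_def f_not_def)

lemma forces_and: "(p \<tturnstile> \<phi> \<^bold>\<and> \<psi>) \<longleftrightarrow> (p \<tturnstile> \<phi>) \<and> (p \<tturnstile> \<psi>)"
  by (simp add: forces_def f_and_def)

lemma forces_all: "(p \<tturnstile> f_all \<phi>) \<longleftrightarrow> (\<forall>a. p \<tturnstile> \<phi> a)"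
  by (simp add: forces_def f_all_def)

lemma forces_imp:
  "(p \<tturnstile> \<phi> \<^bold>\<longrightarrow> \<psi>) \<longleftrightarrow> (\<forall>q. q \<preceq> p \<longrightarrow> (q \<tturnstile> \<phi>) \<longrightarrow> (\<exists>r. r \<preceq> q \<and> (r \<tturnstile> \<psi>)))"
  by (auto simp: f_imp_def forces_not forces_and)

lemma forces_ex:
  "(p \<tturnstile> f_ex \<phi>) \<longleftrightarrow> (\<forall>q. q \<preceq> p \<longrightarrow> (\<exists>r a. r \<preceq> q \<and> (r \<tturnstile> \<phi> a)))"
  unfolding f_ex_def forces_not forces_all by blast

lemma forces_iff:
  "(p \<tturnstile> \<phi> \<^bold>\<longleftrightarrow> \<psi>) \<longleftrightarrow> (p \<tturnstile> \<phi> \<^bold>\<longrightarrow> \<psi>) \<and> (p \<tturnstile> \<psi> \<^bold>\<longrightarrow> \<phi>)"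
  by (simp add: f_iff_def forces_and)

lemma forces_ground: "(p \<tturnstile> \<langle>b\<rangle>) \<longleftrightarrow> b"
  by (simp add: forces_def f_ground_def)

lemma forces_mem:
  "(p \<tturnstile> a \<^bold>\<in> x) \<longleftrightarrow> (\<forall>q. q \<preceq> p \<longrightarrow> (\<exists>r s. r \<preceq> q \<and> r \<preceq> s \<and> (a, s) \<in> x))"
  by (simp add: forces_def f_mem_def)

lemma forces_mem_check_name: "(p \<tturnstile> (n, k) \<^bold>\<in> check_name f) \<longleftrightarrow> k = f n"
  unfolding forces_mem check_name_def by (auto intro: extends_refl)

lemma forces_in_generic:
  "(p \<tturnstile> in_generic s) \<longleftrightarrow> (\<forall>q. q \<preceq> p \<longrightarrow> (\<exists>r. r \<preceq> q \<and> r \<preceq> s))"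
  by (simp add: forces_def in_generic_def)

lemma is_stem_mono:
  assumes "is_stem a R" "is_stem b S" "R \<subseteq> S"
  shows "prefix b a"
proof (rule ccontr)
  assume nb: "\<not> prefix b a"
  have aS: "a \<in> S" using assms by (auto simp: is_stem_def)
  then have "prefix a b" using assms nb by (auto simp: is_stem_def)
  then obtain c where c: "b = a @ c" by (auto simp: prefix_def)
  with nb obtain k c' where kc: "c = k # c'" by (cases c) auto
  have "finite {n. a @ [n] \<notin> R}" using assms by (auto simp: is_stem_def)
  then have "finite (insert k {n. a @ [n] \<notin> R})" by simp
  then obtain n where n: "n \<notin> insert k {n. a @ [n] \<notin> R}"
    using ex_new_if_finite[OF infinite_UNIV_nat] by blast
  then have "a @ [n] \<in> S" "n \<noteq> k" using assms(3) by auto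
  then have "prefix (a @ [n]) b \<or> prefix b (a @ [n])" using assms by (auto simp: is_stem_def)
  then show False using c kc \<open>n \<noteq> k\<close> by auto
qed

lemma is_stem_unique: "is_stem a T \<Longrightarrow> is_stem b T \<Longrightarrow> a = b"
  by (meson is_stem_mono order_refl prefix_order.antisym)

lemma is_stem_stem: "is_stem (stem p) (nodes p)"
proof -
  obtain s where s: "is_stem s (nodes p)" using nodes[of p] by auto
  show ?thesis unfolding stem_def
    by (rule theI[of _ s]) (use s is_stem_unique in auto)
qed

lemma stem_eqI: "is_stem s (nodes p) \<Longrightarrow> stem p = s"
  using is_stem_stem is_stem_unique by blast

lemma is_tree_nodes: "is_tree (nodes p)"
  using nodes[of p] by auto

lemma stem_mono: "q \<preceq> p \<Longrightarrow> prefix (stem p) (stem q)"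
  using is_stem_mono[OF is_stem_stem is_stem_stem] by (auto simp: extends_def)

lemma ex_extension_at:
  assumes "t \<in> nodes p" "prefix (stem p) t"
  shows "\<exists>q. q \<preceq> p \<and> stem q = t"
proof -
  let ?T = "{u \<in> nodes p. prefix u t \<or> prefix t u}"
  have 1: "is_tree ?T"
    using is_tree_nodes[of p] prefix_same_cases prefix_order.trans
    unfolding is_tree_def by blast
  have 2: "is_stem t ?T" unfolding is_stem_def
  proof (intro conjI ballI impI)
    show "t \<in> ?T" using assms by simp
    show "prefix u t \<or> prefix t u" if "u \<in> ?T" for u using that by auto
    show "finite {n. u @ [n] \<notin> ?T}" if "u \<in> ?T" "prefix t u" for u
    proof -
      have "prefix (stem p) u" using that assms prefix_order.trans by blast
      then have "finite {n. u @ [n] \<notin> nodes p}"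
        using is_stem_stem[of p] that by (auto simp: is_stem_def)
      moreover have "{n. u @ [n] \<notin> ?T} \<subseteq> {n. u @ [n] \<notin> nodes p}" using that by auto
      ultimately show ?thesis using finite_subset by blast
    qed
  qed
  have n: "nodes (Abs_dtree ?T) = ?T" using Abs_dtree_inverse[of ?T] 1 2 by blast
  show ?thesis
    by (rule exI[of _ "Abs_dtree ?T"]) (use n 2 in \<open>auto simp: extends_def intro!: stem_eqI\<close>)
qed

lemma ex_long_stem: "\<exists>q. q \<preceq> p \<and> n \<le> length (stem q)"
proof (induction n)
  case 0
  then show ?case by (auto intro: extends_refl)
next
  case (Suc n)
  then obtain q where q: "q \<preceq> p" "n \<le> length (stem q)" by auto
  have "finite {n. stem q @ [n] \<notin> nodes q}"
    using is_stem_stem[of q] by (auto simp: is_stem_def)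
  then obtain k where "stem q @ [k] \<in> nodes q"
    using ex_new_if_finite[OF infinite_UNIV_nat] by blast
  then obtain r where "r \<preceq> q" "stem r = stem q @ [k]"
    using ex_extension_at[of "stem q @ [k]" q] by auto
  then show ?case using q extends_trans by (intro exI[of _ r]) auto
qed

lemma forces_generic_realI:
  "n < length (stem p) \<Longrightarrow> (p \<tturnstile> (n, stem p ! n) \<^bold>\<in> generic_real)"
  unfolding forces_mem generic_real_def by (auto intro: extends_refl)

lemma forces_generic_realD:
  assumes "p \<tturnstile> (n, k) \<^bold>\<in> generic_real" "n < length (stem p)"
  shows "stem p ! n = k"
proof -
  obtain r s where rs: "r \<preceq> p" "r \<preceq> s" "((n, k), s) \<in> generic_real"
    using assms(1) unfolding forces_mem by (meson extends_refl)
  then have "n < length (stem s)" "stem s ! n = k" by (auto simp: generic_real_def)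
  moreover have "stem r ! n = stem p ! n"
    using assms(2) stem_mono[OF rs(1)] by (auto simp: prefix_def nth_append)
  moreover have "stem r ! n = stem s ! n"
    using calculation(1) stem_mono[OF rs(2)] by (auto simp: prefix_def nth_append)
  ultimately show ?thesis by simp
qed

lemma forces_mem_mono: "(p \<tturnstile> a \<^bold>\<in> x) \<Longrightarrow> q \<preceq> p \<Longrightarrow> (q \<tturnstile> a \<^bold>\<in> x)"
  unfolding forces_mem by (meson extends_trans)

theorem is_real_generic_real: "p \<tturnstile> is_real generic_real"
proof -
  have "\<exists>r k. r \<preceq> q \<and> (r \<tturnstile> (n, k) \<^bold>\<in> generic_real)" for q n
    using ex_long_stem[of q "Suc n"] forces_generic_realI by (metis Suc_le_eq)
  moreover have "j = k"
    if "q \<tturnstile> (n, j) \<^bold>\<in> generic_real" "q \<tturnstile> (n, k) \<^bold>\<in> generic_real" for q n j k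
    using ex_long_stem[of q "Suc n"] that forces_mem_mono forces_generic_realD
    by (metis Suc_le_eq)
  ultimately show ?thesis
    unfolding is_real_def forces_all forces_and forces_ex forces_imp forces_ground
    by (meson extends_refl)
qed

lemma forces_is_branch_stem:
  assumes "p \<tturnstile> is_branch generic_real s"
  shows "stem p \<in> nodes s"
proof -
  let ?n = "length (stem p)"
  obtain r t where r: "r \<preceq> p" and t: "t \<in> nodes s" "length t = ?n"
    and b: "r \<tturnstile> (\<^bold>\<forall>i. \<langle>i < ?n\<rangle> \<^bold>\<longrightarrow> (i, t ! i) \<^bold>\<in> generic_real)"
    using assms[unfolded is_branch_def forces_all, rule_format, of ?n]
    unfolding forces_ex forces_and forces_ground by (meson extends_refl)
  have pre: "prefix (stem p) (stem r)" using r by (rule stem_mono)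
  have "stem p ! i = t ! i" if i: "i < ?n" for i
  proof -
    obtain r' where r': "r' \<preceq> r" "r' \<tturnstile> (i, t ! i) \<^bold>\<in> generic_real"
      using b i unfolding forces_all forces_imp forces_ground by (meson extends_refl)
    have pre': "prefix (stem p) (stem r')"
      using pre stem_mono[OF r'(1)] prefix_order.trans by blast
    then have "i < length (stem r')" using i prefix_length_le by fastforce
    then have "stem r' ! i = t ! i" using r'(2) forces_generic_realD by blast
    then show ?thesis using pre' i by (auto simp: prefix_def nth_append)
  qed
  then have "stem p = t" using t by (simp add: nth_equalityI)
  then show ?thesis using t by simp
qed

lemma forces_is_branch_mono:
  assumes "p \<tturnstile> is_branch x s" "q \<preceq> p" shows "q \<tturnstile> is_branch x s"
  using assms unfolding is_branch_def forces_all forces_ex by (meson extends_trans)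

lemma ex_common_extension:
  assumes "stem p \<in> nodes s" "prefix (stem s) (stem p)"
  shows "\<exists>r. r \<preceq> p \<and> r \<preceq> s"
proof -
  let ?T = "nodes p \<inter> nodes s"
  have 1: "is_tree ?T" using is_tree_nodes[of p] is_tree_nodes[of s] by (auto simp: is_tree_def)
  have 2: "is_stem (stem p) ?T" unfolding is_stem_def
  proof (intro conjI ballI impI)
    show "stem p \<in> ?T" using assms is_stem_stem[of p] by (auto simp: is_stem_def)
    show "prefix u (stem p) \<or> prefix (stem p) u" if "u \<in> ?T" for u
      using that is_stem_stem[of p] by (auto simp: is_stem_def)
    show "finite {n. u @ [n] \<notin> ?T}" if u: "u \<in> ?T" "prefix (stem p) u" for u
    proof -
      have "prefix (stem s) u" using u assms prefix_order.trans by blast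
      then have "finite ({n. u @ [n] \<notin> nodes p} \<union> {n. u @ [n] \<notin> nodes s})"
        using is_stem_stem[of p] is_stem_stem[of s] u by (auto simp: is_stem_def)
      then show ?thesis by (rule rev_finite_subset) auto
    qed
  qed
  have "nodes (Abs_dtree ?T) = ?T" using Abs_dtree_inverse[of ?T] 1 2 by blast
  then show ?thesis by (intro exI[of _ "Abs_dtree ?T"]) (auto simp: extends_def)
qed

theorem generic_filter_from_real: "p \<tturnstile> in_generic s \<^bold>\<longleftrightarrow> is_branch generic_real s"
proof -
  have A: "q \<tturnstile> is_branch generic_real s" if g: "q \<tturnstile> in_generic s" for q
    unfolding is_branch_def forces_all forces_ex forces_and forces_imp forces_ground
  proof (intro allI impI)
    fix n q' assume "q' \<preceq> q"
    then obtain r0 where r0: "r0 \<preceq> q'" "r0 \<preceq> s" using g unfolding forces_in_generic by blast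
    obtain r where r: "r \<preceq> r0" "n \<le> length (stem r)" using ex_long_stem by blast
    let ?t = "take n (stem r)"
    have "stem r \<in> nodes s" using is_stem_stem[of r] r r0 by (auto simp: is_stem_def extends_def)
    then have "?t \<in> nodes s" using is_tree_nodes[of s] take_is_prefix unfolding is_tree_def by blast
    moreover have "u \<tturnstile> (i, ?t ! i) \<^bold>\<in> generic_real" if "i < n" "u \<preceq> r" for i u
      using forces_mem_mono[OF forces_generic_realI[of i r]] that r by simp
    ultimately show "\<exists>r t. r \<preceq> q' \<and> (t \<in> nodes s \<and> length t = n) \<and>
        (\<forall>i q. q \<preceq> r \<longrightarrow> i < n \<longrightarrow> (\<exists>r. r \<preceq> q \<and> (r \<tturnstile> (i, t ! i) \<^bold>\<in> generic_real)))"
      using r r0 extends_trans by (intro exI[of _ r] exI[of _ ?t]) (auto intro: extends_refl)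
  qed
  have B: "q \<tturnstile> in_generic s" if br: "q \<tturnstile> is_branch generic_real s" for q
    unfolding forces_in_generic
  proof (intro allI impI)
    fix q' assume q': "q' \<preceq> q"
    obtain u where u: "u \<preceq> q'" "length (stem s) \<le> length (stem u)" using ex_long_stem by blast
    then have "u \<tturnstile> is_branch generic_real s"
      using br q' extends_trans forces_is_branch_mono by blast
    then have us: "stem u \<in> nodes s" by (rule forces_is_branch_stem)
    then have "prefix (stem s) (stem u)"
      using is_stem_stem[of s] u(2) prefix_length_prefix unfolding is_stem_def by blast
    then show "\<exists>r. r \<preceq> q' \<and> r \<preceq> s"
      using ex_common_extension[OF us] u(1) extends_trans by blast
  qed
  show ?thesis unfolding forces_iff forces_imp using A B extends_refl by blast
qed

end

theory Submission
  imports Defs "HOL-Library.Infinite_Set"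
begin

text \<open>
  Call \<open>n\<close> free at a node \<open>t\<close> if no condition with stem \<open>t\<close> forces a bound on \<open>x(n)\<close>. Then there is a
  function \<open>u\<close> tending to infinity such that for infinitely many \<open>k\<close> no condition with stem
  \<open>t @ [k]\<close> forces \<open>x(n) \<le> u(k)\<close>. Select for every \<open>t\<close> a suitable finite set \<open>active t\<close> of
  numbers free at \<open>t\<close>, and let \<open>y(n)\<close> be the minimum of \<open>d(n)\<close> and all \<open>u(d(i))\<close>, where
  \<open>n\<close> is active at \<open>d|i\<close> and \<open>u\<close> belongs to \<open>(d|i, n)\<close>. Since \<open>d(i)\<close> may be required to be as large
  as we like after \<open>d|i\<close> is known, \<open>y\<close> is dominating. If \<open>n\<close> is active at \<open>t\<close>, then some extension
  through \<open>t\<close> forces \<open>x(n) > y(n)\<close>. If below some condition only finitely many numbers were ever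
  active, then bounds on \<open>x(n)\<close> could be forced without changing the stem, and a fusion would yield
  a ground model function bounding \<open>x\<close>.
\<close>

section \<open>Building conditions\<close>

lemma finite_missing_successors:
  assumes "t \<in> nodes q" "prefix (stem q) t"
  shows "finite {k. t @ [k] \<notin> nodes q}"
  using is_stem_stem[of q] assms by (auto simp: is_stem_def)

lemma nodes_prefix_closed: "t \<in> nodes q \<Longrightarrow> prefix u t \<Longrightarrow> u \<in> nodes q"
  using is_tree_nodes[of q] by (auto simp: is_tree_def)

lemma stem_in_nodes: "stem q \<in> nodes q"
  using is_stem_stem[of q] by (auto simp: is_stem_def)

lemma ex_prefix_snoc: "prefix t u \<Longrightarrow> u \<noteq> t \<Longrightarrow> \<exists>k. prefix (t @ [k]) u"
  by (auto simp: prefix_def) (metis neq_Nil_conv)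

lemma ex_condition:
  assumes P: "P s"
    and closed: "\<And>t u. prefix s u \<Longrightarrow> prefix u t \<Longrightarrow> P t \<Longrightarrow> P u"
    and succ: "\<And>t. prefix s t \<Longrightarrow> P t \<Longrightarrow> finite {k. \<not> P (t @ [k])}"
  shows "\<exists>q. stem q = s \<and> nodes q = {t. prefix t s \<or> prefix s t \<and> P t}"
proof -
  let ?T = "{t. prefix t s \<or> prefix s t \<and> P t}"
  have 1: "is_tree ?T" unfolding is_tree_def
  proof (intro ballI allI impI)
    fix t u assume t: "t \<in> ?T" and u: "prefix u t"
    show "u \<in> ?T"
    proof (cases "prefix t s")
      case True
      then show ?thesis using u prefix_order.trans by blast
    next
      case False
      then have "prefix s t" "P t" using t by auto
      then show ?thesis using u closed prefix_same_cases[of u t s] by blast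
    qed
  qed
  have 2: "is_stem s ?T" unfolding is_stem_def
  proof (intro conjI ballI impI)
    show "s \<in> ?T" by simp
    show "prefix t s \<or> prefix s t" if "t \<in> ?T" for t using that by auto
    show "finite {k. t @ [k] \<notin> ?T}" if "t \<in> ?T" "prefix s t" for t
    proof -
      have "P t" using that P prefix_order.antisym by blast
      then have "finite {k. \<not> P (t @ [k])}" using succ that by blast
      then show ?thesis by (rule rev_finite_subset) (use that in auto)
    qed
  qed
  have n: "nodes (Abs_dtree ?T) = ?T" using Abs_dtree_inverse[of ?T] 1 2 by blast
  then show ?thesis using 2 stem_eqI[of s "Abs_dtree ?T"] by auto
qed

text \<open>This stands in for a fusion sequence: infinitely many requirements are met at once,
  without lengthening the stem, as long as each node loses only finitely many successors to
  them.\<close>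

lemma ex_pruning:
  assumes P: "P (stem q)"
    and closed: "\<And>t u. prefix (stem q) u \<Longrightarrow> prefix u t \<Longrightarrow> P t \<Longrightarrow> P u"
    and succ: "\<And>t. prefix (stem q) t \<Longrightarrow> t \<in> nodes q \<Longrightarrow> P t \<Longrightarrow>
      finite {k. t @ [k] \<in> nodes q \<and> \<not> P (t @ [k])}"
  shows "\<exists>r. r \<preceq> q \<and> stem r = stem q \<and> (\<forall>t\<in>nodes r. prefix (stem q) t \<longrightarrow> P t)"
proof -
  have "\<exists>r. stem r = stem q \<and>
      nodes r = {t. prefix t (stem q) \<or> prefix (stem q) t \<and> t \<in> nodes q \<and> P t}"
  proof (rule ex_condition)
    show "stem q \<in> nodes q \<and> P (stem q)" using P stem_in_nodes by blast
    show "u \<in> nodes q \<and> P u"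
      if "prefix (stem q) u" "prefix u t" "t \<in> nodes q \<and> P t" for t u
      using that closed nodes_prefix_closed by blast
    show "finite {k. \<not> (t @ [k] \<in> nodes q \<and> P (t @ [k]))}"
      if "prefix (stem q) t" "t \<in> nodes q \<and> P t" for t
    proof -
      have "finite ({k. t @ [k] \<notin> nodes q} \<union> {k. t @ [k] \<in> nodes q \<and> \<not> P (t @ [k])})"
        using that finite_missing_successors succ by simp
      then show ?thesis by (rule rev_finite_subset) auto
    qed
  qed
  then obtain r where r: "stem r = stem q"
      "nodes r = {t. prefix t (stem q) \<or> prefix (stem q) t \<and> t \<in> nodes q \<and> P t}"
    by blast
  have "r \<preceq> q" unfolding extends_def r(2)
    using nodes_prefix_closed[OF stem_in_nodes] by blast
  moreover have "P t" if "t \<in> nodes r" "prefix (stem q) t" for t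
    using that P prefix_order.antisym unfolding r(2) by blast
  ultimately show ?thesis using r(1) by blast
qed

lemma extends_stem_in_nodes: "r \<preceq> q \<Longrightarrow> stem r \<in> nodes q"
  using stem_in_nodes[of r] by (auto simp: extends_def)


section \<open>Bounds that can be forced without changing the stem\<close>

text \<open>The forcing of \<open>x(n) \<le> v\<close>, written out as density below
  \<open>p\<close>.\<close>

definition forces_le :: "name \<Rightarrow> nat \<Rightarrow> nat \<Rightarrow> dtree \<Rightarrow> bool" where
  "forces_le x n v p \<longleftrightarrow> (\<forall>q. q \<preceq> p \<longrightarrow> (\<exists>r j. r \<preceq> q \<and> j \<le> v \<and> (r \<tturnstile> (n, j) \<^bold>\<in> x)))"

text \<open>Conditions with the same stem are compatible, so a bound forced by one of them is never
  refuted by another. If it fails, every condition with stem \<open>t\<close> has an extension below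
  which no value \<open>j \<le> v\<close> is ever forced for \<open>x(n)\<close>.\<close>

definition stem_bounds :: "name \<Rightarrow> nat list \<Rightarrow> nat \<Rightarrow> nat \<Rightarrow> bool" where
  "stem_bounds x t n v \<longleftrightarrow> (\<exists>q. stem q = t \<and> forces_le x n v q)"

definition free_at :: "name \<Rightarrow> nat list \<Rightarrow> nat \<Rightarrow> bool" where
  "free_at x t n \<longleftrightarrow> (\<forall>v. \<not> stem_bounds x t n v)"

text \<open>Glue together the conditions \<open>Q k\<close> above all good successors
  \<open>t @ [k]\<close>. Every extension of the result can be extended through some good
  \<open>t @ [k]\<close> and is then compatible with \<open>Q k\<close>. The contrapositive supplies
  the infinite sets from which \<open>slow\<close> is built.\<close>

lemma stem_bounds_if_successors:
  assumes fin: "finite {k. \<not> stem_bounds x (t @ [k]) n v}"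
  shows "stem_bounds x t n v"
proof -
  let ?good = "\<lambda>k. stem_bounds x (t @ [k]) n v"
  have "\<forall>k. \<exists>q. ?good k \<longrightarrow> stem q = t @ [k] \<and> forces_le x n v q"
    unfolding stem_bounds_def by blast
  then obtain Q where Q: "\<And>k. ?good k \<Longrightarrow> stem (Q k) = t @ [k] \<and> forces_le x n v (Q k)"
    by metis
  \<comment> \<open>Vacuous at \<open>t\<close>. For a proper extension of \<open>t\<close> exactly
    one \<open>k\<close> satisfies the premise, and it selects the condition to stay in.\<close>
  let ?P = "\<lambda>u. \<forall>k. prefix (t @ [k]) u \<longrightarrow> ?good k \<and> u \<in> nodes (Q k)"
  have "\<exists>q. stem q = t \<and> nodes q = {u. prefix u t \<or> prefix t u \<and> ?P u}"
  proof (rule ex_condition)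
    show "?P t" by (auto simp: prefix_def)
    show "?P u" if "prefix u u'" "?P u'" for u u'
      using that nodes_prefix_closed prefix_order.trans by meson
    show "finite {k. \<not> ?P (u @ [k])}" if u: "prefix t u" "?P u" for u
    proof (cases "u = t")
      case True
      have "?P (t @ [k])" if "?good k" for k
        using that Q[OF that] stem_in_nodes[of "Q k"] by auto
      then have "{k. \<not> ?P (u @ [k])} \<subseteq> {k. \<not> ?good k}" using True by blast
      then show ?thesis using fin finite_subset by blast
    next
      case False
      then obtain k0 where k0: "prefix (t @ [k0]) u"
        using u(1) ex_prefix_snoc by blast
      then have g: "?good k0" "u \<in> nodes (Q k0)" using u by auto
      have "finite {k. u @ [k] \<notin> nodes (Q k0)}"
        using finite_missing_successors[OF g(2)] Q[OF g(1)] k0 by simp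
      moreover have "{k. \<not> ?P (u @ [k])} \<subseteq> {k. u @ [k] \<notin> nodes (Q k0)}"
      proof -
        have "k1 = k0" if "prefix (t @ [k1]) (u @ [k])" for k k1
          using that k0 by (auto simp: prefix_def)
        then show ?thesis using g by blast
      qed
      ultimately show ?thesis using finite_subset by blast
    qed
  qed
  then obtain q where q: "stem q = t" "nodes q = {u. prefix u t \<or> prefix t u \<and> ?P u}" by blast
  have "forces_le x n v q" unfolding forces_le_def
  proof (intro allI impI)
    fix r assume r: "r \<preceq> q"
    obtain r' where r': "r' \<preceq> r" "Suc (length t) \<le> length (stem r')" using ex_long_stem by blast
    have "stem r' \<in> nodes q" using r r' extends_trans extends_stem_in_nodes by blast
    moreover have "\<not> prefix (stem r') t" using r'(2) prefix_length_le by fastforce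
    ultimately have *: "prefix t (stem r')" "?P (stem r')" using q by auto
    then obtain k where k: "prefix (t @ [k]) (stem r')"
      using \<open>\<not> prefix (stem r') t\<close> ex_prefix_snoc by blast
    then have g: "?good k" "stem r' \<in> nodes (Q k)" using * by auto
    then obtain w where w: "w \<preceq> r'" "w \<preceq> Q k"
      using ex_common_extension[of r' "Q k"] Q[OF g(1)] k by auto
    then show "\<exists>w j. w \<preceq> r \<and> j \<le> v \<and> (w \<tturnstile> (n, j) \<^bold>\<in> x)"
      using Q[OF g(1)] r' extends_trans unfolding forces_le_def by meson
  qed
  then show ?thesis using q unfolding stem_bounds_def by blast
qed

text \<open>Pick \<open>e m\<close> in \<open>A m\<close>, strictly increasing in \<open>m\<close>,
  and let \<open>u\<close> invert \<open>e\<close>, rounding up. Then \<open>u (e m) = m\<close>, so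
  every \<open>e m\<close> lies in \<open>A (u (e m))\<close>, and \<open>k \<le> e (u k)\<close>
  makes \<open>u\<close> tend to infinity.\<close>

lemma ex_slow_function:
  fixes A :: "nat \<Rightarrow> nat set"
  assumes inf: "\<And>v. infinite (A v)"
  shows "\<exists>u :: nat \<Rightarrow> nat. (\<forall>b. finite {k. u k < b}) \<and> infinite {k. k \<in> A (u k)}"
proof -
  have "\<exists>e :: nat \<Rightarrow> nat. \<forall>m. e m \<in> A m \<and> e m < e (Suc m)"
  proof (rule dependent_nat_choice)
    show "\<exists>k. k \<in> A 0" using inf[of 0] by (metis ex_in_conv finite.emptyI)
    show "\<exists>k'. k' \<in> A (Suc m) \<and> k < k'" for k m
      using inf[of "Suc m"] unfolding infinite_nat_iff_unbounded by blast
  qed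
  then obtain e where e: "\<And>m. e m \<in> A m" "strict_mono e" by (auto simp: strict_mono_Suc_iff)
  define u where "u k = (LEAST m. k \<le> e m)" for k
  have ue: "u (e m) = m" for m unfolding u_def
    by (rule Least_equality) (auto simp: e(2) strict_mono_less_eq)
  have le: "k \<le> e (u k)" for k unfolding u_def
    by (rule LeastI[of _ k]) (simp add: e(2) strict_mono_imp_increasing)
  have "finite {k. u k < b}" for b
  proof (rule finite_subset)
    show "{k. u k < b} \<subseteq> {..e b}"
      using le e(2) by (metis (mono_tags) atMost_iff less_imp_le mem_Collect_eq order.trans
          strict_mono_less_eq subsetI)
  qed simp
  moreover have "infinite {k. k \<in> A (u k)}"
  proof (rule infinite_super)
    show "range e \<subseteq> {k. k \<in> A (u k)}" using e(1) ue by auto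
    show "infinite (range e)" using e(2) strict_mono_imp_inj_on finite_imageD infinite_UNIV_nat by blast
  qed
  ultimately show ?thesis by blast
qed

definition slow_for :: "name \<Rightarrow> nat list \<Rightarrow> nat \<Rightarrow> (nat \<Rightarrow> nat) \<Rightarrow> bool" where
  "slow_for x t n u \<longleftrightarrow>
     (\<forall>b. finite {k. u k < b}) \<and> infinite {k. \<not> stem_bounds x (t @ [k]) n (u k)}"

text \<open>Arbitrary unless \<open>n\<close> is free at \<open>t\<close>; as \<open>active\<close>
  contains only free numbers, \<open>val\<close> evaluates it nowhere else.\<close>

definition slow :: "name \<Rightarrow> nat list \<Rightarrow> nat \<Rightarrow> nat \<Rightarrow> nat" where
  "slow x t n = (SOME u. slow_for x t n u)"

lemma slow_for_slow:
  assumes "free_at x t n"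
  shows "slow_for x t n (slow x t n)"
proof -
  have "infinite {k. \<not> stem_bounds x (t @ [k]) n v}" for v
    using assms stem_bounds_if_successors unfolding free_at_def by blast
  from ex_slow_function[of "\<lambda>v. {k. \<not> stem_bounds x (t @ [k]) n v}", OF this]
  have "\<exists>u. slow_for x t n u" unfolding slow_for_def by simp
  then show ?thesis unfolding slow_def by (rule someI_ex)
qed


section \<open>Free pairs occur along the generic branch\<close>

text \<open>Unlike the length, the weight leaves only finitely many nodes below each bound, yet
  along a branch it is never smaller than the length.\<close>

definition weight :: "nat list \<Rightarrow> nat" where
  "weight t = length t + sum_list t"

lemma weight_mono: "prefix s t \<Longrightarrow> weight s \<le> weight t"
  by (auto simp: weight_def prefix_def)

lemma finite_weight_le: "finite {t. weight t \<le> n}"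
proof (rule finite_subset)
  show "{t. weight t \<le> n} \<subseteq> {t. set t \<subseteq> {..n} \<and> length t \<le> n}"
    using member_le_sum_list by (fastforce simp: weight_def)
  show "finite {t. set t \<subseteq> {..n} \<and> length t \<le> n}" by (simp add: finite_lists_length_le)
qed

text \<open>If no \<open>n \<ge> weight t\<close> is free at \<open>t\<close>, then the value of \<open>LEAST\<close> is arbitrary, which does no
  harm: it only matters that the set is finite.\<close>

definition active :: "name \<Rightarrow> nat list \<Rightarrow> nat set" where
  "active x t = {n. length t \<le> Suc n \<and> free_at x t n \<and>
     n \<le> max (weight t) (LEAST n. weight t \<le> n \<and> free_at x t n)}"

lemma finite_active: "finite (active x t)"
  by (rule finite_subset[of _ "{..max (weight t) (LEAST n. weight t \<le> n \<and> free_at x t n)}"])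
    (auto simp: active_def)

text \<open>Cutting down to a finite set loses nothing: a free number above \<open>weight t\<close>
  can be replaced by the least free one from \<open>weight t\<close> on, which is at least
  \<open>m\<close> because \<open>m \<le> length t \<le> weight t\<close>.\<close>

lemma ex_active_if_free:
  assumes "free_at x t n" "m \<le> n" "m \<le> length t" "length t \<le> Suc n"
  shows "\<exists>n'\<ge>m. n' \<in> active x t"
proof (cases "n \<le> weight t")
  case True
  then show ?thesis using assms by (auto simp: active_def)
next
  case False
  let ?Q = "\<lambda>n. weight t \<le> n \<and> free_at x t n"
  have "?Q (LEAST n. ?Q n)" by (rule LeastI[of ?Q n]) (use False assms in auto)
  moreover have "length t \<le> weight t" by (simp add: weight_def)
  ultimately have "(LEAST n. ?Q n) \<in> active x t" "m \<le> (LEAST n. ?Q n)"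
    using assms unfolding active_def by auto
  then show ?thesis by blast
qed

section \<open>Unfolding the forcing of eventual domination\<close>

lemma forces_ex_pair_le:
  "(q \<tturnstile> (\<^bold>\<exists>j. \<^bold>\<exists>k. (n, j) \<^bold>\<in> x \<^bold>\<and> (n, k) \<^bold>\<in> y \<^bold>\<and> \<langle>j \<le> k\<rangle>)) \<longleftrightarrow>
    (\<forall>r. r \<preceq> q \<longrightarrow> (\<exists>w j k. w \<preceq> r \<and> (w \<tturnstile> (n, j) \<^bold>\<in> x) \<and> (w \<tturnstile> (n, k) \<^bold>\<in> y) \<and> j \<le> k))"
  (is "?L \<longleftrightarrow> ?R")
proof
  assume L: ?L
  show ?R
  proof (intro allI impI)
    fix r assume "r \<preceq> q"
    then obtain w j where w: "w \<preceq> r"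
      "w \<tturnstile> (\<^bold>\<exists>k. (n, j) \<^bold>\<in> x \<^bold>\<and> (n, k) \<^bold>\<in> y \<^bold>\<and> \<langle>j \<le> k\<rangle>)"
      using L unfolding forces_ex[of q] by blast
    then obtain w' k where "w' \<preceq> w" "w' \<tturnstile> (n, j) \<^bold>\<in> x" "w' \<tturnstile> (n, k) \<^bold>\<in> y" "j \<le> k"
      unfolding forces_ex forces_and forces_ground using extends_refl by blast
    then show "\<exists>w j k. w \<preceq> r \<and> (w \<tturnstile> (n, j) \<^bold>\<in> x) \<and> (w \<tturnstile> (n, k) \<^bold>\<in> y) \<and> j \<le> k"
      using w(1) extends_trans by blast
  qed
next
  assume R: ?R
  show ?L unfolding forces_ex[of q]
  proof (intro allI impI)
    fix r assume "r \<preceq> q"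
    then obtain w j k where w: "w \<preceq> r" "w \<tturnstile> (n, j) \<^bold>\<in> x" "w \<tturnstile> (n, k) \<^bold>\<in> y" "j \<le> k"
      using R by blast
    then have "w \<tturnstile> (\<^bold>\<exists>k. (n, j) \<^bold>\<in> x \<^bold>\<and> (n, k) \<^bold>\<in> y \<^bold>\<and> \<langle>j \<le> k\<rangle>)"
      unfolding forces_ex forces_and forces_ground using forces_mem_mono extends_refl by blast
    then show "\<exists>w j. w \<preceq> r \<and> (w \<tturnstile> (\<^bold>\<exists>k. (n, j) \<^bold>\<in> x \<^bold>\<and> (n, k) \<^bold>\<in> y \<^bold>\<and> \<langle>j \<le> k\<rangle>))"
      using w(1) by blast
  qed
qed

definition some_le :: "name \<Rightarrow> name \<Rightarrow> nat \<Rightarrow> dtree \<Rightarrow> bool" where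
  "some_le x y n q \<longleftrightarrow> (\<exists>w j k. w \<preceq> q \<and> (w \<tturnstile> (n, j) \<^bold>\<in> x) \<and> (w \<tturnstile> (n, k) \<^bold>\<in> y) \<and> j \<le> k)"

lemma forces_le_star:
  "(q \<tturnstile> x \<^bold>\<le>\<^sup>* y) \<longleftrightarrow> (\<forall>q'. q' \<preceq> q \<longrightarrow>
     (\<exists>r m. r \<preceq> q' \<and> (\<forall>n\<ge>m. \<forall>r'. r' \<preceq> r \<longrightarrow> some_le x y n r')))"
proof -
  \<comment> \<open>\<open>some_le\<close> passes to weaker conditions, which collapses the nested
    density quantifiers.\<close>
  have mono: "some_le x y n r" if "some_le x y n w" "w \<preceq> r" for n w r
    using that extends_trans unfolding some_le_def by meson
  have "(r \<tturnstile> (\<^bold>\<forall>n. \<langle>m \<le> n\<rangle> \<^bold>\<longrightarrow>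
      (\<^bold>\<exists>j. \<^bold>\<exists>k. (n, j) \<^bold>\<in> x \<^bold>\<and> (n, k) \<^bold>\<in> y \<^bold>\<and> \<langle>j \<le> k\<rangle>))) \<longleftrightarrow>
    (\<forall>n\<ge>m. \<forall>r'. r' \<preceq> r \<longrightarrow> some_le x y n r')" (is "?L \<longleftrightarrow> ?R") for r m
  proof -
    have "?L \<longleftrightarrow> (\<forall>n q. q \<preceq> r \<longrightarrow> m \<le> n \<longrightarrow> (\<exists>r. r \<preceq> q \<and> (\<forall>r'. r' \<preceq> r \<longrightarrow> some_le x y n r')))"
      unfolding forces_all forces_imp forces_ground forces_ex_pair_le some_le_def ..
    also have "\<dots> \<longleftrightarrow> ?R"
      by (meson mono extends_refl extends_trans)
    finally show ?thesis .
  qed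
  then show ?thesis unfolding le_star_def forces_ex[of q] by simp
qed

lemma forces_le_starI:
  assumes "\<And>n r. m \<le> n \<Longrightarrow> r \<preceq> q \<Longrightarrow> some_le x y n r"
  shows "q \<tturnstile> x \<^bold>\<le>\<^sup>* y"
  unfolding forces_le_star
proof (intro allI impI)
  fix r assume "r \<preceq> q"
  then have "\<forall>n\<ge>m. \<forall>r'. r' \<preceq> r \<longrightarrow> some_le x y n r'" using assms extends_trans by blast
  then show "\<exists>w m. w \<preceq> r \<and> (\<forall>n\<ge>m. \<forall>r'. r' \<preceq> w \<longrightarrow> some_le x y n r')"
    using extends_refl by blast
qed

lemma forces_le_star_dense:
  assumes "\<And>r. r \<preceq> q \<Longrightarrow> \<exists>w. w \<preceq> r \<and> (w \<tturnstile> x \<^bold>\<le>\<^sup>* y)"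
  shows "q \<tturnstile> x \<^bold>\<le>\<^sup>* y"
  unfolding forces_le_star
proof (intro allI impI)
  fix r assume "r \<preceq> q"
  then obtain w where w: "w \<preceq> r" "w \<tturnstile> x \<^bold>\<le>\<^sup>* y" using assms by blast
  obtain w' m where "w' \<preceq> w" "\<forall>n\<ge>m. \<forall>r'. r' \<preceq> w' \<longrightarrow> some_le x y n r'"
    using w(2)[unfolded forces_le_star, rule_format, OF extends_refl] by blast
  then show "\<exists>w m. w \<preceq> r \<and> (\<forall>n\<ge>m. \<forall>r'. r' \<preceq> w \<longrightarrow> some_le x y n r')"
    using w(1) extends_trans by blast
qed

section \<open>Weight crossings and the existence of active pairs\<close>

lemma ex_crossing_prefix:
  assumes "prefix s u" "weight s \<le> n" "n < weight u"
  shows "\<exists>w. prefix w u \<and> strict_prefix s w \<and> weight (butlast w) \<le> n \<and> n < weight w"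
  using assms
proof (induction u rule: rev_induct)
  case Nil
  then show ?case by simp
next
  case (snoc k u)
  show ?case
  proof (cases "n < weight u \<and> prefix s u")
    case True
    then obtain w where w: "prefix w u" "strict_prefix s w" "weight (butlast w) \<le> n" "n < weight w"
      using snoc.IH snoc.prems by blast
    then have "prefix w (u @ [k])" by simp
    then show ?thesis using w by blast
  next
    case False
    \<comment> \<open>Here \<open>weight u \<le> n\<close>, so the last step from \<open>u\<close>
      to \<open>u @ [k]\<close> is the crossing.\<close>
    have "s \<noteq> u @ [k]" using snoc.prems by auto
    then have "prefix s u" using snoc.prems by simp
    then show ?thesis using False snoc.prems
      by (intro exI[of _ "u @ [k]"]) (auto simp: strict_prefix_def)
  qed
qed

text \<open>If not, each \<open>t\<close> in \<open>r\<close> and large \<open>n\<close> come with a condition \<open>Q t n\<close> of stem \<open>t\<close> that bounds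
  \<open>x(n)\<close>. Prune \<open>r\<close> so that the generic branch stays in \<open>Q (butlast w) n\<close> or, failing that, in
  \<open>Q w n\<close>, where \<open>w\<close> is its first initial segment of weight above \<open>n\<close>. For given \<open>n\<close> only finitely
  many stems are then relevant, since \<open>Q (butlast w) n\<close> omits only finitely many successors of
  its stem; so a ground model function bounds \<open>x\<close>.\<close>

lemma ex_active:
  assumes unb: "r \<tturnstile> unbounded x"
  shows "\<exists>t n. t \<in> nodes r \<and> prefix (stem r) t \<and> m \<le> n \<and> n \<in> active x t"
proof (rule ccontr)
  assume neg: "\<not> ?thesis"
  \<comment> \<open>With a stem of length at least \<open>m\<close>, every node above it is long
    enough for \<open>ex_active_if_free\<close> to yield an active number at least
    \<open>m\<close>.\<close>
  obtain q where q: "q \<preceq> r" "m \<le> length (stem q)" using ex_long_stem by blast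
  let ?s = "stem q"
  have "\<not> free_at x t n"
    if t: "t \<in> nodes q" "prefix ?s t" "length t \<le> Suc n" "m \<le> n" for t n
  proof
    assume "free_at x t n"
    moreover have "m \<le> length t" using q(2) t(2) prefix_length_le order.trans by blast
    ultimately obtain n' where "n' \<ge> m" "n' \<in> active x t" using ex_active_if_free t by blast
    moreover have "t \<in> nodes r" using t q by (auto simp: extends_def)
    moreover have "prefix (stem r) t" using stem_mono[OF q(1)] t(2) prefix_order.trans by blast
    ultimately show False using neg by blast
  qed
  then have "\<forall>t n. \<exists>Q v. t \<in> nodes q \<and> prefix ?s t \<and> length t \<le> Suc n \<and> m \<le> n \<longrightarrow>
      stem Q = t \<and> forces_le x n v Q"
    unfolding free_at_def stem_bounds_def by blast
  then obtain Q F where QF: "\<And>t n. t \<in> nodes q \<Longrightarrow> prefix ?s t \<Longrightarrow> length t \<le> Suc n \<Longrightarrow> m \<le> n \<Longrightarrow>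
      stem (Q t n) = t \<and> forces_le x n (F t n) (Q t n)"
    by metis
  define ctl where "ctl w n = (if w \<in> nodes (Q (butlast w) n) then butlast w else w)" for w n
  let ?cross = "\<lambda>w n. strict_prefix ?s w \<and> weight (butlast w) \<le> n \<and> n < weight w"
  have cross: "\<exists>a k. w = a @ [k] \<and> a \<in> nodes q \<and> prefix ?s a \<and> length a \<le> n \<and> m \<le> n"
    if w: "w \<in> nodes q" "?cross w n" for w n
  proof (cases w rule: rev_cases)
    case Nil
    then show ?thesis using w by simp
  next
    case (snoc a k)
    have "prefix ?s a" using w snoc by (auto simp: strict_prefix_def)
    moreover have "a \<in> nodes q" using w snoc nodes_prefix_closed[of w q a] by simp
    moreover have "length a \<le> n" using w snoc by (simp add: weight_def)
    moreover have "m \<le> n" using prefix_length_le[OF calculation(1)] calculation(3) q(2) by simp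
    ultimately show ?thesis using snoc by blast
  qed
  have ctl: "stem (Q (ctl w n) n) = ctl w n \<and> forces_le x n (F (ctl w n) n) (Q (ctl w n) n) \<and>
      prefix (ctl w n) w \<and> w \<in> nodes (Q (ctl w n) n)"
    if w: "w \<in> nodes q" "?cross w n" for w n
  proof -
    obtain a k where a: "w = a @ [k]" "a \<in> nodes q" "prefix ?s a" "length a \<le> n" "m \<le> n"
      using cross[OF w] by blast
    show ?thesis
    proof (cases "w \<in> nodes (Q a n)")
      case True
      then have "ctl w n = a" using a(1) by (simp add: ctl_def)
      then show ?thesis using QF[of a n] a True by simp
    next
      case False
      then have c: "ctl w n = w" using a(1) by (simp add: ctl_def)
      \<comment> \<open>The crossing node \<open>w\<close> may have length \<open>n + 1\<close>;
        this is why \<open>active\<close> admits \<open>length t \<le> Suc n\<close>.\<close>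
      have "stem (Q w n) = w \<and> forces_le x n (F w n) (Q w n)"
        by (rule QF) (use a w in auto)
      then show ?thesis using c stem_in_nodes[of "Q w n"] by simp
    qed
  qed
  let ?P = "\<lambda>u. \<forall>w n. prefix w u \<longrightarrow> ?cross w n \<longrightarrow> u \<in> nodes (Q (ctl w n) n)"
  have "\<exists>r. r \<preceq> q \<and> stem r = ?s \<and> (\<forall>t\<in>nodes r. prefix ?s t \<longrightarrow> ?P t)"
  proof (rule ex_pruning)
    show "?P ?s" using prefix_order.less_le_not_le by blast
    show "?P u" if "prefix u t" "?P t" for t u
      using that nodes_prefix_closed prefix_order.trans by meson
    show "finite {k. t @ [k] \<in> nodes q \<and> \<not> ?P (t @ [k])}"
      if t: "prefix ?s t" "t \<in> nodes q" "?P t" for t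
    proof (rule finite_subset)
      let ?I = "{(w, n). prefix w t \<and> ?cross w n}"
      show "{k. t @ [k] \<in> nodes q \<and> \<not> ?P (t @ [k])} \<subseteq>
          (\<Union>(w, n)\<in>?I. {k. t @ [k] \<notin> nodes (Q (ctl w n) n)})"
      proof
        fix k assume "k \<in> {k. t @ [k] \<in> nodes q \<and> \<not> ?P (t @ [k])}"
        then obtain w n where k: "t @ [k] \<in> nodes q" and
          w: "prefix w (t @ [k])" "?cross w n" "t @ [k] \<notin> nodes (Q (ctl w n) n)" by blast
        \<comment> \<open>A crossing at \<open>t @ [k]\<close> itself excludes nothing, since
          \<open>ctl\<close> selects a condition containing that node. Only the finitely many
          crossings at or below \<open>t\<close> can remove successors.\<close>
        have "w \<noteq> t @ [k]" using ctl[of "t @ [k]" n] k w by blast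
        then have "prefix w t" using w by simp
        then show "k \<in> (\<Union>(w, n)\<in>?I. {k. t @ [k] \<notin> nodes (Q (ctl w n) n)})" using w by auto
      qed
      have "?I \<subseteq> set (prefixes t) \<times> {..<weight t}"
        using weight_mono by (auto intro: less_le_trans)
      then have "finite ?I" by (rule finite_subset) simp
      moreover have "finite {k. t @ [k] \<notin> nodes (Q (ctl w n) n)}"
        if w: "prefix w t" "?cross w n" for w n
      proof (rule finite_missing_successors)
        show "t \<in> nodes (Q (ctl w n) n)" using t w by blast
        show "prefix (stem (Q (ctl w n) n)) t"
          using ctl[of w n] w t nodes_prefix_closed prefix_order.trans by metis
      qed
      ultimately show "finite (\<Union>(w, n)\<in>?I. {k. t @ [k] \<notin> nodes (Q (ctl w n) n)})" by auto
    qed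
  qed
  then obtain q' where q': "q' \<preceq> q" "stem q' = ?s"
    and P: "\<And>t. t \<in> nodes q' \<Longrightarrow> prefix ?s t \<Longrightarrow> ?P t" by blast
  define S where "S n = {t \<in> nodes q. prefix ?s t \<and> weight t \<le> n}" for n
  \<comment> \<open>\<open>E n\<close> collects all possible values of \<open>ctl w n\<close>: a
    node of weight at most \<open>n\<close>, or one of its finitely many successors that its own
    condition \<open>Q t n\<close> omits.\<close>
  define E where "E n = S n \<union> (\<Union>t\<in>S n. (\<lambda>k. t @ [k]) ` {k. t @ [k] \<notin> nodes (Q t n)})" for n
  define h where "h n = (\<Sum>t\<in>E n. F t n)" for n
  have finE: "finite (E n)" for n
  proof -
    have "finite {k. t @ [k] \<notin> nodes (Q t n)}" if "t \<in> S n" for t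
    proof -
      have "prefix ?s t" "length t \<le> n" using that by (auto simp: S_def weight_def)
      moreover from this have "m \<le> n" using q(2) prefix_length_le order.trans by meson
      ultimately have "stem (Q t n) = t" using QF that by (auto simp: S_def)
      then show ?thesis using finite_missing_successors[of t "Q t n"] stem_in_nodes[of "Q t n"] by simp
    qed
    moreover have "finite (S n)"
      by (rule finite_subset[OF _ finite_weight_le[of n]]) (auto simp: S_def)
    ultimately show ?thesis unfolding E_def by auto
  qed
  have F_le: "F (ctl w n) n \<le> h n" if w: "w \<in> nodes q" "?cross w n" for w n
  proof -
    obtain a k where a: "w = a @ [k]" "a \<in> nodes q" "prefix ?s a" using cross[OF w] by blast
    then have "a \<in> S n" using w by (simp add: S_def)
    then have "ctl w n \<in> E n" using a(1) unfolding ctl_def E_def by auto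
    then show ?thesis unfolding h_def using finE by (intro member_le_sum) auto
  qed
  have "forces_le x n (h n) q'" if n: "weight ?s \<le> n" for n
    unfolding forces_le_def
  proof (intro allI impI)
    fix r1 assume r1: "r1 \<preceq> q'"
    \<comment> \<open>A stem longer than \<open>n\<close> has weight above \<open>n\<close>, so it
      has already crossed, and the crossing selects the condition that bounds
      \<open>x(n)\<close>.\<close>
    obtain r2 where r2: "r2 \<preceq> r1" "Suc n \<le> length (stem r2)" using ex_long_stem by blast
    let ?u = "stem r2"
    have u: "?u \<in> nodes q'" using r1 r2 extends_trans extends_stem_in_nodes by blast
    have su: "prefix ?s ?u" using stem_mono[of r2 q'] r1 r2 extends_trans q' by metis
    have "n < weight ?u" using r2 by (simp add: weight_def)
    then obtain w where w: "prefix w ?u" "?cross w n" using ex_crossing_prefix[OF su n] by blast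
    have wq: "w \<in> nodes q" using w u q' nodes_prefix_closed unfolding extends_def by blast
    have "?u \<in> nodes (Q (ctl w n) n)" using P[OF u su] w by blast
    moreover have "prefix (stem (Q (ctl w n) n)) ?u"
      using ctl[OF wq w(2)] w(1) prefix_order.trans by metis
    ultimately obtain r3 where r3: "r3 \<preceq> r2" "r3 \<preceq> Q (ctl w n) n"
      using ex_common_extension by blast
    then obtain r4 j where r4: "r4 \<preceq> r3" "j \<le> F (ctl w n) n" "r4 \<tturnstile> (n, j) \<^bold>\<in> x"
      using ctl[OF wq w(2)] unfolding forces_le_def by blast
    then show "\<exists>r j. r \<preceq> r1 \<and> j \<le> h n \<and> (r \<tturnstile> (n, j) \<^bold>\<in> x)"
      using F_le[OF wq w(2)] r3 r2 extends_trans order.trans by meson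
  qed
  then have "q' \<tturnstile> x \<^bold>\<le>\<^sup>* check_name h"
    unfolding forces_le_def
    by (intro forces_le_starI[of "weight ?s"]) (simp add: some_le_def forces_mem_check_name, blast)
  moreover have "q' \<preceq> r" using q q' extends_trans by blast
  ultimately show False using unb unfolding unbounded_def forces_all forces_not by blast
qed


section \<open>The dominating real\<close>

text \<open>Inserting \<open>s ! n\<close> keeps the minimum defined when no pair is active. The
  range \<open>i \<le> Suc n\<close> loses no active pair, by the length bound in
  \<open>active\<close>, and makes the value depend on the first \<open>n + 2\<close> entries only,
  whence the \<open>n + 2\<close> in \<open>dom_name\<close>.\<close>

definition val :: "name \<Rightarrow> nat list \<Rightarrow> nat \<Rightarrow> nat" where
  "val x s n = Min (insert (s ! n)
     ((\<lambda>i. slow x (take i s) n (s ! i)) ` {i. i \<le> Suc n \<and> n \<in> active x (take i s)}))"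

definition dom_name :: "name \<Rightarrow> name" where
  "dom_name x = {((n, val x (stem q) n), q) | n q. n + 2 \<le> length (stem q)}"

lemma val_prefix:
  assumes "prefix s t" "n + 2 \<le> length s"
  shows "val x t n = val x s n"
proof -
  obtain r where t: "t = s @ r" using assms(1) by (auto simp: prefix_def)
  have "take i t = take i s" "t ! i = s ! i" if "i \<le> Suc n" for i
    using that assms(2) by (auto simp: t nth_append)
  then show ?thesis unfolding val_def
    by (intro arg_cong[of _ _ Min] arg_cong2[of _ _ _ _ insert] image_cong) auto
qed

lemma val_le:
  assumes "prefix (t @ [k]) s" "n \<in> active x t"
  shows "val x s n \<le> slow x t n k"
proof -
  have "take (length t) s = t" "s ! length t = k" "length t \<le> Suc n"
    using assms by (auto simp: prefix_def active_def nth_append)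
  then show ?thesis unfolding val_def using assms(2) by (intro Min_le) (auto intro!: image_eqI)
qed

lemma le_val:
  assumes "v \<le> s ! n" "\<And>i. i \<le> Suc n \<Longrightarrow> n \<in> active x (take i s) \<Longrightarrow> v \<le> slow x (take i s) n (s ! i)"
  shows "v \<le> val x s n"
  unfolding val_def using assms by (subst Min_ge_iff) auto

lemma forces_dom_nameI:
  "n + 2 \<le> length (stem q) \<Longrightarrow> (q \<tturnstile> (n, val x (stem q) n) \<^bold>\<in> dom_name x)"
  unfolding forces_mem dom_name_def by (auto intro: extends_refl)

lemma forces_dom_nameD:
  assumes "q \<tturnstile> (n, k) \<^bold>\<in> dom_name x" "n + 2 \<le> length (stem q)"
  shows "k = val x (stem q) n"
proof -
  obtain r s where rs: "r \<preceq> q" "r \<preceq> s" "((n, k), s) \<in> dom_name x"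
    using assms(1) unfolding forces_mem by (meson extends_refl)
  then have "k = val x (stem s) n" "n + 2 \<le> length (stem s)" by (auto simp: dom_name_def)
  then show ?thesis
    using val_prefix[OF stem_mono[OF rs(1)] assms(2)] val_prefix[OF stem_mono[OF rs(2)]] by simp
qed

lemma is_real_dom_name: "p \<tturnstile> is_real (dom_name x)"
proof -
  have "\<exists>r k. r \<preceq> q \<and> (r \<tturnstile> (n, k) \<^bold>\<in> dom_name x)" for q n
    using ex_long_stem[of q "n + 2"] forces_dom_nameI by blast
  moreover have "j = k"
    if "q \<tturnstile> (n, j) \<^bold>\<in> dom_name x" "q \<tturnstile> (n, k) \<^bold>\<in> dom_name x" for q n j k
    using ex_long_stem[of q "n + 2"] that forces_mem_mono forces_dom_nameD by metis
  ultimately show ?thesis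
    unfolding is_real_def forces_all forces_and forces_ex forces_imp forces_ground
    by (meson extends_refl)
qed

text \<open>Above any stem, require of each entry \<open>k\<close> following \<open>t\<close> that
  it is at least \<open>f (length t)\<close> and that \<open>f n \<le> slow x t n k\<close> for all
  \<open>n\<close> active at \<open>t\<close>. This excludes finitely many \<open>k\<close>, since
  \<open>slow\<close> tends to infinity and \<open>active x t\<close> is finite.\<close>

lemma dominating_dom_name: "p \<tturnstile> dominating (dom_name x)"
  unfolding dominating_def forces_all
proof
  fix f
  have main: "\<exists>r. r \<preceq> q \<and> (r \<tturnstile> check_name f \<^bold>\<le>\<^sup>* dom_name x)" for q
  proof -
    let ?s = "stem q"
    let ?ok = "\<lambda>t k. f (length t) \<le> k \<and> (\<forall>n\<in>active x t. f n \<le> slow x t n k)"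
    let ?P = "\<lambda>u. \<forall>t k. prefix (t @ [k]) u \<longrightarrow> prefix ?s t \<longrightarrow> ?ok t k"
    have "\<exists>r. r \<preceq> q \<and> stem r = ?s \<and> (\<forall>t\<in>nodes r. prefix ?s t \<longrightarrow> ?P t)"
    proof (rule ex_pruning)
      show "?P ?s" by (auto simp: prefix_def)
      show "?P u" if "prefix u t" "?P t" for t u using that prefix_order.trans by meson
      show "finite {k. t @ [k] \<in> nodes q \<and> \<not> ?P (t @ [k])}" if t: "?P t" for t
      proof (rule finite_subset)
        show "{k. t @ [k] \<in> nodes q \<and> \<not> ?P (t @ [k])} \<subseteq>
            {..<f (length t)} \<union> (\<Union>n\<in>active x t. {k. slow x t n k < f n})"
        proof
          fix k assume "k \<in> {k. t @ [k] \<in> nodes q \<and> \<not> ?P (t @ [k])}"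
          then obtain a j where "prefix (a @ [j]) (t @ [k])" "prefix ?s a" "\<not> ?ok a j" by blast
          moreover from this have "\<not> prefix (a @ [j]) t" using t by blast
          ultimately have "\<not> ?ok t k" by auto
          then show "k \<in> {..<f (length t)} \<union> (\<Union>n\<in>active x t. {k. slow x t n k < f n})"
            by (auto simp: not_le)
        qed
        have "finite {k. slow x t n k < f n}" if "n \<in> active x t" for n
          using slow_for_slow[of x t n] that by (auto simp: active_def slow_for_def)
        then show "finite ({..<f (length t)} \<union> (\<Union>n\<in>active x t. {k. slow x t n k < f n}))"
          using finite_active by auto
      qed
    qed
    then obtain r where r: "r \<preceq> q" "stem r = ?s"
      and P: "\<And>t. t \<in> nodes r \<Longrightarrow> prefix ?s t \<Longrightarrow> ?P t" by blast
    \<comment> \<open>Pruning has no control over entries inside the stem; \<open>m\<close> is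
      chosen beyond its length and beyond all numbers active at its proper initial segments.\<close>
    have "finite ({..<length ?s} \<union> (\<Union>i<length ?s. active x (take i ?s)))"
      using finite_active by auto
    then obtain m where "\<forall>n\<in>{..<length ?s} \<union> (\<Union>i<length ?s. active x (take i ?s)). n < m"
      using finite_nat_set_iff_bounded by blast
    then have m: "length ?s \<le> n" "\<And>i. i < length ?s \<Longrightarrow> n \<notin> active x (take i ?s)" if "m \<le> n" for n
      using that by (force simp: not_less[symmetric])+
    have "f n \<le> val x (stem w) n" if w: "w \<preceq> r" "m \<le> n" "n + 2 \<le> length (stem w)" for w n
    proof -
      let ?u = "stem w"
      have su: "prefix ?s ?u" using stem_mono[OF w(1)] r(2) by simp
      then obtain z where z: "?u = ?s @ z" by (auto simp: prefix_def)
      have ok: "?ok (take i ?u) (?u ! i)" if "length ?s \<le> i" "i < length ?u" for i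
      proof -
        have "prefix (take i ?u @ [?u ! i]) ?u"
          using that by (metis take_Suc_conv_app_nth take_is_prefix)
        moreover have "prefix ?s (take i ?u)" using that z by simp
        ultimately show ?thesis using P[OF extends_stem_in_nodes[OF w(1)] su] by blast
      qed
      show ?thesis
      proof (rule le_val)
        show "f n \<le> ?u ! n" using ok[of n] m(1) w by simp
        show "f n \<le> slow x (take i ?u) n (?u ! i)" if "i \<le> Suc n" "n \<in> active x (take i ?u)" for i
        proof -
          have "\<not> i < length ?s" using m(2)[of n i] w that z by auto
          then show ?thesis using ok[of i] that w by auto
        qed
      qed
    qed
    then have "some_le (check_name f) (dom_name x) n r'" if "m \<le> n" "r' \<preceq> r" for n r'
      using ex_long_stem[of r' "n + 2"] forces_dom_nameI that extends_trans
      unfolding some_le_def forces_mem_check_name by meson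
    then have "r \<tturnstile> check_name f \<^bold>\<le>\<^sup>* dom_name x" by (rule forces_le_starI)
    then show ?thesis using r by blast
  qed
  show "p \<tturnstile> check_name f \<^bold>\<le>\<^sup>* dom_name x"
    by (rule forces_le_star_dense) (rule main)
qed

text \<open>For \<open>n\<close> active at \<open>t\<close>, a branch through \<open>t @ [k]\<close>
  caps \<open>y(n)\<close> by \<open>slow x t n k\<close>, while for infinitely many
  \<open>k\<close> no condition with stem \<open>t @ [k]\<close> forces \<open>x(n)\<close> to
  respect that cap. Unboundedness of \<open>x\<close> provides such \<open>n\<close> past any
  threshold.\<close>

lemma not_le_star_dom_name:
  assumes unb: "p \<tturnstile> unbounded x"
  shows "p \<tturnstile> \<^bold>\<not> (x \<^bold>\<le>\<^sup>* dom_name x)"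
  unfolding forces_not
proof (intro allI impI notI)
  fix q assume q: "q \<preceq> p" and le: "q \<tturnstile> x \<^bold>\<le>\<^sup>* dom_name x"
  obtain r m where r: "r \<preceq> q"
    and below: "\<And>n r'. m \<le> n \<Longrightarrow> r' \<preceq> r \<Longrightarrow> some_le x (dom_name x) n r'"
    using le[unfolded forces_le_star, rule_format, OF extends_refl] by blast
  have "r \<tturnstile> unbounded x"
    using unb q r extends_trans unfolding unbounded_def forces_all forces_not by meson
  then obtain t n where t: "t \<in> nodes r" "prefix (stem r) t" "m \<le> n" "n \<in> active x t"
    using ex_active by blast
  have "infinite {k. \<not> stem_bounds x (t @ [k]) n (slow x t n k)}"
    using slow_for_slow[of x t n] t(4) by (auto simp: active_def slow_for_def)
  \<comment> \<open>Only finitely many successors of \<open>t\<close> are missing from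
    \<open>r\<close>, so one of the infinitely many suitable \<open>k\<close> survives
    there.\<close>
  then have "infinite ({k. \<not> stem_bounds x (t @ [k]) n (slow x t n k)} - {k. t @ [k] \<notin> nodes r})"
    using finite_missing_successors t by (intro Diff_infinite_finite) auto
  then obtain k where k: "\<not> stem_bounds x (t @ [k]) n (slow x t n k)" "t @ [k] \<in> nodes r"
    by (metis (mono_tags, lifting) DiffE ex_in_conv finite.emptyI mem_Collect_eq)
  obtain r1 where r1: "r1 \<preceq> r" "stem r1 = t @ [k]"
    using ex_extension_at[OF k(2)] t(2) by auto
  then obtain r2 where r2: "r2 \<preceq> r1"
    and no: "\<And>w j. w \<preceq> r2 \<Longrightarrow> j \<le> slow x t n k \<Longrightarrow> \<not> (w \<tturnstile> (n, j) \<^bold>\<in> x)"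
    using k(1) unfolding stem_bounds_def forces_le_def by blast
  obtain w j v where w: "w \<preceq> r2" "w \<tturnstile> (n, j) \<^bold>\<in> x" "w \<tturnstile> (n, v) \<^bold>\<in> dom_name x" "j \<le> v"
    using below[of n r2] t(3) r1 r2 extends_trans unfolding some_le_def by blast
  obtain w' where w': "w' \<preceq> w" "n + 2 \<le> length (stem w')" using ex_long_stem by blast
  have "v = val x (stem w') n" using forces_dom_nameD w w' forces_mem_mono by blast
  also have "\<dots> \<le> slow x t n k"
    using val_le[OF _ t(4)] stem_mono[of w' r1] r1 r2 w w' extends_trans by metis
  finally show False using no w by (meson order.trans)
qed

theorem theorem1:
  fixes p :: dtree
  shows "p \<tturnstile> (\<^bold>\<forall>x. is_real x \<^bold>\<and> unbounded x \<^bold>\<longrightarrow>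
           (\<^bold>\<exists>y. is_real y \<^bold>\<and> dominating y \<^bold>\<and> \<^bold>\<not> (x \<^bold>\<le>\<^sup>* y)))"
proof -
  have "q \<tturnstile> (\<^bold>\<exists>y. is_real y \<^bold>\<and> dominating y \<^bold>\<and> \<^bold>\<not> (x \<^bold>\<le>\<^sup>* y))" if q: "q \<tturnstile> unbounded x" for q x
  proof -
    have "r \<tturnstile> unbounded x" if "r \<preceq> q" for r
      using q that extends_trans unfolding unbounded_def forces_all forces_not by meson
    then show ?thesis
      unfolding forces_ex forces_and
      using is_real_dom_name dominating_dom_name not_le_star_dom_name extends_refl by meson
  qed
  then show ?thesis
    unfolding forces_all forces_imp forces_and using extends_refl by meson
qed

end
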